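(* Let $L_1>0$, $\Omega=(0,L_1)$ (so $n=1$) and $V_\Omega\equiv0$. Then the fundamental gap $\delta_{\rm per}(\alpha)$ of the fractional Schrödinger operator $(-\Delta)^{\alpha/2}+V_\Omega=(-\Delta)^{\alpha/2}$ on $\Omega$ with periodic boundary conditions is $$\delta_{\rm per}(\alpha)=\frac{(2\pi)^{\alpha}(2^{\alpha}-1)}{L_1^{\alpha}},\qquad 0<\alpha\le2.$$
   Context: For $\Omega=\prod_{j=1}^n(0,L_j)$ consider the eigenvalue problem $[(-\Delta)^{\alpha/2}+V_\Omega(\mathbf x)]\phi=\lambda\phi$ in $\Omega$ with $\phi$ periodic with respect to $\Omega$ (period $L_j$ in the $j$-th coordinate), $\phi\neq0$. In the periodic setting, $(-\Delta)^{\alpha/2}$ is defined through the spectral decomposition of the periodic Laplacian: it acts on $e^{i\mathbf k\cdot\mathbf x}$, $\mathbf k=(2\pi m_1/L_1,\dots,2\pi m_n/L_n)$, $\mathbf m\in\mathbb Z^n$, as multiplication by $|\mathbf k|^{\alpha}$. The fundamental gap is $\delta_{\rm per}(\alpha):=\lambda_2(\alpha)-\lambda_1(\alpha)$, where $0<\lambda_1(\alpha)<\lambda_2(\alpha)$ are the two smallest distinct strictly positive eigenvalues (for $V_\Omega\equiv0$ the eigenvalue $0$, with constant eigenfunction, is not counted). *)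

theory Defs
  imports "HOL-Analysis.Analysis"
begin

text \<open>
  The domain is \<open>\<Omega> = box 0 L\<close>, a rectangular box with side lengths \<open>L \<bullet> b\<close> for \<open>b \<in> Basis\<close>;
  for the Euclidean space \<^typ>\<open>real\<close> this is the interval from \<open>0\<close> to \<open>L\<close>.
\<close>

definition wave_vectors :: "'a::euclidean_space \<Rightarrow> 'a set" where
  "wave_vectors L = {k. \<forall>b\<in>Basis. \<exists>m::int. k \<bullet> b = 2 * pi * of_int m / (L \<bullet> b)}"

definition plane_wave :: "'a::euclidean_space \<Rightarrow> 'a \<Rightarrow> complex" where
  "plane_wave k x = exp (\<i> * of_real (k \<bullet> x))"

definition L2_periodic :: "'a::euclidean_space \<Rightarrow> ('a \<Rightarrow> complex) set" where
  "L2_periodic L = {f. (\<forall>x. \<forall>b\<in>Basis. f (x + (L \<bullet> b) *\<^sub>R b) = f x) \<and>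
     f \<in> borel_measurable (lebesgue_on (box 0 L)) \<and>
     integrable (lebesgue_on (box 0 L)) (\<lambda>x. (cmod (f x))\<^sup>2)}"

definition fourier_coeff :: "'a::euclidean_space \<Rightarrow> ('a \<Rightarrow> complex) \<Rightarrow> 'a \<Rightarrow> complex" where
  "fourier_coeff L f k =
     (LINT x|lebesgue_on (box 0 L). f x * cnj (plane_wave k x)) / of_real (\<Prod>b\<in>Basis. L \<bullet> b)"

text \<open>
  \<open>has_frac_laplacian \<alpha> L f g\<close> says that \<open>f\<close> lies in the domain of \<open>(-\<Delta>)\<^sup>\<alpha>\<^sup>/\<^sup>2\<close> and that
  \<open>g\<close> represents \<open>(-\<Delta>)\<^sup>\<alpha>\<^sup>/\<^sup>2 f\<close>, which is unique up to null sets in \<open>\<Omega>\<close>: the series of all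
  \<open>|k|\<^sup>\<alpha> f\<^sub>k e\<^sub>k\<close>, with \<open>f\<^sub>k\<close> the Fourier coefficients of \<open>f\<close> and \<open>e\<^sub>k\<close> the plane waves,
  converges (unconditionally) to \<open>g\<close> in the mean-square sense on \<open>\<Omega>\<close>.
\<close>

definition has_frac_laplacian ::
  "real \<Rightarrow> 'a::euclidean_space \<Rightarrow> ('a \<Rightarrow> complex) \<Rightarrow> ('a \<Rightarrow> complex) \<Rightarrow> bool" where
  "has_frac_laplacian \<alpha> L f g \<longleftrightarrow>
     f \<in> L2_periodic L \<and> g \<in> L2_periodic L \<and>
     ((\<lambda>K. LINT x|lebesgue_on (box 0 L).
         (cmod (g x - (\<Sum>k\<in>K. of_real (norm k powr \<alpha>) * fourier_coeff L f k * plane_wave k x)))\<^sup>2)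
       \<longlongrightarrow> 0) (finite_subsets_at_top (wave_vectors L))"

text \<open>
  Functions are identified when they agree almost everywhere in \<open>\<Omega>\<close>, so an eigenfunction is
  required not to vanish almost everywhere.
\<close>

definition periodic_eigenvalue ::
  "real \<Rightarrow> 'a::euclidean_space \<Rightarrow> ('a \<Rightarrow> real) \<Rightarrow> real \<Rightarrow> bool" where
  "periodic_eigenvalue \<alpha> L V \<mu> \<longleftrightarrow>
     (\<exists>\<phi> g. has_frac_laplacian \<alpha> L \<phi> g \<and>
        (AE x in lebesgue_on (box 0 L). g x + of_real (V x) * \<phi> x = of_real \<mu> * \<phi> x) \<and>
        \<not> (AE x in lebesgue_on (box 0 L). \<phi> x = 0))"

text \<open>
  The gap is introduced as a relation, like \<^const>\<open>has_integral\<close>, so that the existence of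
  the two smallest distinct positive eigenvalues is part of what it asserts.
\<close>

definition has_periodic_fundamental_gap ::
  "real \<Rightarrow> 'a::euclidean_space \<Rightarrow> ('a \<Rightarrow> real) \<Rightarrow> real \<Rightarrow> bool" where
  "has_periodic_fundamental_gap \<alpha> L V \<delta> \<longleftrightarrow>
     (\<exists>\<mu>\<^sub>1 \<mu>\<^sub>2. 0 < \<mu>\<^sub>1 \<and> \<mu>\<^sub>1 < \<mu>\<^sub>2 \<and>
        periodic_eigenvalue \<alpha> L V \<mu>\<^sub>1 \<and> periodic_eigenvalue \<alpha> L V \<mu>\<^sub>2 \<and>
        (\<forall>\<mu>>0. periodic_eigenvalue \<alpha> L V \<mu> \<longrightarrow> \<mu> = \<mu>\<^sub>1 \<or> \<mu>\<^sub>2 \<le> \<mu>) \<and>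
        \<delta> = \<mu>\<^sub>2 - \<mu>\<^sub>1)"

lemma has_periodic_fundamental_gap_unique:
  assumes "has_periodic_fundamental_gap \<alpha> L V d" "has_periodic_fundamental_gap \<alpha> L V d'"
  shows "d = d'"
  using assms unfolding has_periodic_fundamental_gap_def by (smt (verit))

end

theory Submission imports Defs begin

text \<open>
  The plane waves with period \<open>L\<close> are eigenfunctions of the fractional Laplacian, with eigenvalues
  \<open>(2 * pi * m / L) powr \<alpha>\<close> for \<open>m = 0, 1, 2, \<dots>\<close>. This sequence is strictly increasing, so once it
  is known that no other positive eigenvalue exists, the gap is the difference between the terms
  for \<open>m = 2\<close> and \<open>m = 1\<close>.

  The absence of other eigenvalues comes from comparing Fourier coefficients. Let \<open>f\<close> be in the
  domain and let \<open>g\<close> be its image. Each Fourier coefficient is a bounded linear functional of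
  the square-integrable functions, so the mean-square convergence in the definition of the operator
  forces the \<open>k\<close>-th coefficient of \<open>g\<close> to be \<open>|k| powr \<alpha>\<close> times that of \<open>f\<close>
  (\<open>fourier_coeff_frac_laplacian\<close>). If \<open>g = \<mu> f\<close> and \<open>\<mu>\<close> differs from every \<open>|k| powr \<alpha>\<close>, all
  coefficients of \<open>f\<close> are therefore zero. Then the series that defines \<open>g\<close> is identically zero, hence
  \<open>g = 0\<close> almost everywhere, and for \<open>\<mu> > 0\<close> also \<open>f = 0\<close> almost everywhere
  (\<open>positive_eigenvalue_iff\<close>).
\<close>

section \<open>Periodic square-integrable functions and their Fourier coefficients\<close>

lemma finite_measure_box: "finite_measure (lebesgue_on (box 0 (L::'a::euclidean_space)))"
  by (rule finite_measure_lebesgue_on) simp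

lemma (in finite_measure) integrable_of_square_integrable:
  fixes f :: "'a \<Rightarrow> complex"
  assumes [measurable]: "f \<in> borel_measurable M" and "integrable M (\<lambda>x. (cmod (f x))\<^sup>2)"
  shows "integrable M f"
proof (rule Bochner_Integration.integrable_bound)
  show "integrable M (\<lambda>x. 1 + (cmod (f x))\<^sup>2)"
    using assms by simp
  have "t \<le> 1 + t\<^sup>2" for t :: real
    using zero_le_power2[of "2 * t - 1"] by (simp add: power2_diff power_mult_distrib)
  then show "AE x in M. norm (f x) \<le> norm (1 + (cmod (f x))\<^sup>2)"
    by simp
qed simp

text \<open>
  The Cauchy--Schwarz inequality against the constant function, from the nonnegativity of the
  integral of \<open>(m |f| - a)\<^sup>2\<close>, where \<open>m\<close> is the total mass and \<open>a\<close> the integral of \<open>|f|\<close>.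
\<close>

lemma (in finite_measure) norm_integral_square_le:
  fixes f :: "'a \<Rightarrow> complex"
  assumes "f \<in> borel_measurable M" and sq: "integrable M (\<lambda>x. (cmod (f x))\<^sup>2)"
  shows "(cmod (\<integral>x. f x \<partial>M))\<^sup>2 \<le> measure M (space M) * (\<integral>x. (cmod (f x))\<^sup>2 \<partial>M)"
proof -
  define a where "a = (\<integral>x. cmod (f x) \<partial>M)"
  define m where "m = measure M (space M)"
  have f: "integrable M f"
    using assms by (rule integrable_of_square_integrable)
  have "0 \<le> (\<integral>x. (m * cmod (f x) - a)\<^sup>2 \<partial>M)"
    by simp
  also have "\<dots> = (\<integral>x. m\<^sup>2 * (cmod (f x))\<^sup>2 - 2 * m * a * cmod (f x) + a\<^sup>2 \<partial>M)"
    by (rule Bochner_Integration.integral_cong) (simp_all add: power2_diff power_mult_distrib)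
  also have "\<dots> = m\<^sup>2 * (\<integral>x. (cmod (f x))\<^sup>2 \<partial>M) - 2 * m * a * a + a\<^sup>2 * m"
    using f sq by (simp add: a_def m_def)
  also have "\<dots> = m * (m * (\<integral>x. (cmod (f x))\<^sup>2 \<partial>M) - a\<^sup>2)"
    by (simp add: algebra_simps power2_eq_square)
  finally have *: "0 \<le> m * (m * (\<integral>x. (cmod (f x))\<^sup>2 \<partial>M) - a\<^sup>2)" .
  have "0 \<le> a"
    by (simp add: a_def)
  have "a\<^sup>2 \<le> m * (\<integral>x. (cmod (f x))\<^sup>2 \<partial>M)"
  proof (cases "m = 0")
    case True
    then have "emeasure M (space M) = 0"
      by (simp add: m_def emeasure_eq_measure)
    then have "AE x in M. False"
      by (intro AE_I[of _ _ "space M"]) auto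
    then have "a = (\<integral>x. 0 \<partial>M)"
      unfolding a_def using f by (intro integral_cong_AE) auto
    then show ?thesis
      by (simp add: True)
  next
    case False
    then have "m > 0"
      by (simp add: m_def zero_less_measure_iff)
    then show ?thesis
      using * by (simp add: zero_le_mult_iff)
  qed
  moreover have "(cmod (\<integral>x. f x \<partial>M))\<^sup>2 \<le> a\<^sup>2"
    unfolding a_def by (intro power_mono integral_norm_bound) simp
  ultimately show ?thesis
    by (simp add: m_def)
qed

lemma L2_periodic_measurable:
  "f \<in> L2_periodic L \<Longrightarrow> f \<in> borel_measurable (lebesgue_on (box 0 L))"
  by (simp add: L2_periodic_def)

lemma L2_periodic_square_integrable:
  "f \<in> L2_periodic L \<Longrightarrow> integrable (lebesgue_on (box 0 L)) (\<lambda>x. (cmod (f x))\<^sup>2)"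
  by (simp add: L2_periodic_def)

lemma L2_periodic_cmult:
  assumes "f \<in> L2_periodic L"
  shows "(\<lambda>x. c * f x) \<in> L2_periodic L"
  using assms by (auto simp: L2_periodic_def norm_mult power_mult_distrib)

lemma L2_periodic_add:
  assumes "f \<in> L2_periodic L" "g \<in> L2_periodic L"
  shows "(\<lambda>x. f x + g x) \<in> L2_periodic L"
proof -
  let ?M = "lebesgue_on (box 0 L)"
  note [measurable] = assms[THEN L2_periodic_measurable]
  have "integrable ?M (\<lambda>x. (cmod (f x + g x))\<^sup>2)"
  proof (rule Bochner_Integration.integrable_bound)
    show "integrable ?M (\<lambda>x. 2 * (cmod (f x))\<^sup>2 + 2 * (cmod (g x))\<^sup>2)"
      using assms[THEN L2_periodic_square_integrable] by simp
    have "(cmod (f x + g x))\<^sup>2 \<le> 2 * (cmod (f x))\<^sup>2 + 2 * (cmod (g x))\<^sup>2" for x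
    proof -
      have "(cmod (f x + g x))\<^sup>2 \<le> (cmod (f x) + cmod (g x))\<^sup>2"
        by (intro power_mono norm_triangle_ineq) simp
      also have "\<dots> \<le> 2 * (cmod (f x))\<^sup>2 + 2 * (cmod (g x))\<^sup>2"
        using zero_le_power2[of "cmod (f x) - cmod (g x)"] by (simp add: power2_sum power2_diff)
      finally show ?thesis .
    qed
    then show "AE x in ?M. norm ((cmod (f x + g x))\<^sup>2) \<le> norm (2 * (cmod (f x))\<^sup>2 + 2 * (cmod (g x))\<^sup>2)"
      by simp
  qed simp
  then show ?thesis
    using assms by (auto simp: L2_periodic_def)
qed

lemma L2_periodic_diff:
  assumes "f \<in> L2_periodic L" "g \<in> L2_periodic L"
  shows "(\<lambda>x. f x - g x) \<in> L2_periodic L"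
  using L2_periodic_add[OF assms(1) L2_periodic_cmult[OF assms(2), of "-1"]] by simp

lemma L2_periodic_sum:
  assumes "\<And>i. i \<in> I \<Longrightarrow> f i \<in> L2_periodic L"
  shows "(\<lambda>x. \<Sum>i\<in>I. f i x) \<in> L2_periodic L"
  using assms
proof (induction I rule: infinite_finite_induct)
  case (insert i I)
  then show ?case
    using L2_periodic_add[of "f i" L "\<lambda>x. \<Sum>i\<in>I. f i x"] by simp
qed (auto simp: L2_periodic_def)

lemma norm_plane_wave [simp]: "cmod (plane_wave k x) = 1"
  by (simp add: plane_wave_def)

lemma continuous_on_plane_wave: "continuous_on S (plane_wave k)"
  unfolding plane_wave_def by (intro continuous_intros)

lemma plane_wave_measurable [measurable]:
  "plane_wave k \<in> borel_measurable (lebesgue_on (box 0 L))"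
  by (intro continuous_imp_measurable_on_sets_lebesgue continuous_on_plane_wave) simp

lemma cnj_plane_wave: "cnj (plane_wave k x) = plane_wave (- k) x"
  by (simp add: plane_wave_def exp_cnj)

lemma times_plane_wave_measurable:
  assumes "f \<in> L2_periodic L"
  shows "(\<lambda>x. f x * cnj (plane_wave k x)) \<in> borel_measurable (lebesgue_on (box 0 L))"
proof -
  note [measurable] = L2_periodic_measurable[OF assms]
  show ?thesis
    unfolding cnj_plane_wave by measurable
qed

lemma plane_wave_mult_cnj: "plane_wave k x * cnj (plane_wave l x) = plane_wave (k - l) x"
  by (simp add: plane_wave_def exp_cnj exp_add[symmetric] algebra_simps inner_diff_left)

lemma plane_wave_add: "plane_wave k (x + y) = plane_wave k x * plane_wave k y"
  by (simp add: plane_wave_def exp_add[symmetric] algebra_simps inner_add_right)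

lemma plane_wave_period:
  assumes "k \<in> wave_vectors L" "b \<in> Basis"
  shows "plane_wave k ((L \<bullet> b) *\<^sub>R b) = 1"
proof (cases "L \<bullet> b = 0")
  case True
  then show ?thesis by (simp add: plane_wave_def)
next
  case False
  obtain m :: int where "k \<bullet> b = 2 * pi * of_int m / (L \<bullet> b)"
    using assms by (auto simp: wave_vectors_def)
  then have "k \<bullet> ((L \<bullet> b) *\<^sub>R b) = 2 * pi * of_int m"
    using False by simp
  then show ?thesis
    using exp_integer_2pi[of "of_int m"] by (simp add: plane_wave_def mult_ac)
qed

lemma plane_wave_in_L2_periodic:
  assumes "k \<in> wave_vectors L"
  shows "plane_wave k \<in> L2_periodic L"
  using assms finite_measure.integrable_const[OF finite_measure_box, of L]
  by (auto simp: L2_periodic_def plane_wave_add plane_wave_period)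

lemma integrable_times_plane_wave:
  assumes "f \<in> L2_periodic L"
  shows "integrable (lebesgue_on (box 0 L)) (\<lambda>x. f x * cnj (plane_wave k x))"
proof (rule finite_measure.integrable_of_square_integrable[OF finite_measure_box])
  show "(\<lambda>x. f x * cnj (plane_wave k x)) \<in> borel_measurable (lebesgue_on (box 0 L))"
    using assms by (rule times_plane_wave_measurable)
  show "integrable (lebesgue_on (box 0 L)) (\<lambda>x. (cmod (f x * cnj (plane_wave k x)))\<^sup>2)"
    using L2_periodic_square_integrable[OF assms] by (simp add: norm_mult)
qed

lemma fourier_coeff_cmult: "fourier_coeff L (\<lambda>x. c * f x) k = c * fourier_coeff L f k"
  by (simp add: fourier_coeff_def mult.assoc)

lemma fourier_coeff_diff:
  assumes "f \<in> L2_periodic L" "g \<in> L2_periodic L"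
  shows "fourier_coeff L (\<lambda>x. f x - g x) k = fourier_coeff L f k - fourier_coeff L g k"
  using assms[THEN integrable_times_plane_wave]
  by (simp add: fourier_coeff_def left_diff_distrib diff_divide_distrib)

lemma fourier_coeff_sum:
  assumes "\<And>i. i \<in> I \<Longrightarrow> f i \<in> L2_periodic L"
  shows "fourier_coeff L (\<lambda>x. \<Sum>i\<in>I. f i x) k = (\<Sum>i\<in>I. fourier_coeff L (f i) k)"
  using assms[THEN integrable_times_plane_wave]
  by (simp add: fourier_coeff_def sum_distrib_right sum_divide_distrib)

lemma fourier_coeff_cong_AE:
  assumes "f \<in> L2_periodic L" "g \<in> L2_periodic L"
    and "AE x in lebesgue_on (box 0 L). f x = g x"
  shows "fourier_coeff L f k = fourier_coeff L g k"
proof -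
  have "(LINT x|lebesgue_on (box 0 L). f x * cnj (plane_wave k x))
      = (LINT x|lebesgue_on (box 0 L). g x * cnj (plane_wave k x))"
    by (rule integral_cong_AE) (use assms in \<open>auto intro: times_plane_wave_measurable\<close>)
  then show ?thesis
    by (simp add: fourier_coeff_def)
qed

text \<open>
  Continuity of the coefficient functionals in the mean-square norm. A single term of Bessel's
  inequality is enough, and it follows from Cauchy--Schwarz since plane waves have modulus one.
\<close>

lemma fourier_coeff_bound:
  fixes L :: real
  assumes "0 < L" "f \<in> L2_periodic L"
  shows "L * (cmod (fourier_coeff L f k))\<^sup>2 \<le> (LINT x|lebesgue_on (box 0 L). (cmod (f x))\<^sup>2)"
proof -
  let ?M = "lebesgue_on (box 0 L)"
  have "(cmod (LINT x|?M. f x * cnj (plane_wave k x)))\<^sup>2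
      \<le> measure ?M (space ?M) * (LINT x|?M. (cmod (f x * cnj (plane_wave k x)))\<^sup>2)"
    using times_plane_wave_measurable[OF assms(2)] L2_periodic_square_integrable[OF assms(2)]
    by (intro finite_measure.norm_integral_square_le[OF finite_measure_box])
      (simp_all add: norm_mult)
  also have "\<dots> = L * (LINT x|?M. (cmod (f x))\<^sup>2)"
    using assms(1) by (simp add: norm_mult measure_restrict_space)
  finally show ?thesis
    using assms(1) by (simp add: fourier_coeff_def norm_divide power_divide field_simps power2_eq_square)
qed

text \<open>
  Orthonormality: for \<open>c = k - l \<noteq> 0\<close> the plane wave \<open>e\<^sub>c\<close> has the antiderivative \<open>e\<^sub>c / (\<i> c)\<close>, which
  takes the same value at both ends of the period.
\<close>

lemma fourier_coeff_plane_wave: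
  fixes L :: real
  assumes "0 < L" "k \<in> wave_vectors L" "l \<in> wave_vectors L"
  shows "fourier_coeff L (plane_wave k) l = (if k = l then 1 else 0)"
proof (cases "k = l")
  case True
  then have "plane_wave k x * cnj (plane_wave l x) = 1" for x
    by (simp add: plane_wave_mult_cnj) (simp add: plane_wave_def)
  then show ?thesis
    using assms(1) True
    by (simp add: fourier_coeff_def measure_restrict_space scaleR_conv_of_real)
next
  case False
  define c where "c = k - l"
  have "c \<noteq> 0"
    using False by (simp add: c_def)
  have per: "plane_wave c L = 1"
    using plane_wave_period[OF assms(2), of 1] plane_wave_period[OF assms(3), of 1]
    by (simp add: c_def plane_wave_mult_cnj[symmetric])
  have "((\<lambda>x. plane_wave c x / (\<i> * of_real c)) has_vector_derivative plane_wave c x) (at x within {0..L})"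
    for x
  proof -
    have "((\<lambda>z. exp (\<i> * (of_real c * z)) / (\<i> * of_real c)) has_field_derivative
        exp (\<i> * (of_real c * of_real x))) (at (of_real x))"
      using \<open>c \<noteq> 0\<close> by (auto intro!: derivative_eq_intros simp: field_simps)
    from has_vector_derivative_real_field[OF this] show ?thesis
      by (simp add: plane_wave_def)
  qed
  then have *: "(plane_wave c has_integral
      plane_wave c L / (\<i> * of_real c) - plane_wave c 0 / (\<i> * of_real c)) {0..L}"
    using assms(1) by (intro fundamental_theorem_of_calculus) auto
  have "(LINT x|lebesgue_on (box 0 L). plane_wave c x) = integral (box 0 L) (plane_wave c)"
  proof (rule lebesgue_integral_eq_integral)
    show "integrable (lebesgue_on (box 0 L)) (plane_wave c)"
      using integrable_times_plane_wave[OF plane_wave_in_L2_periodic[OF assms(2)], of l]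
      by (simp add: plane_wave_mult_cnj c_def)
  qed simp
  also have "\<dots> = integral {0..L} (plane_wave c)"
    by (simp add: integral_open_interval_real)
  also have "\<dots> = 0"
    using integral_unique[OF *] per by (simp add: plane_wave_def)
  finally show ?thesis
    using False by (simp add: fourier_coeff_def plane_wave_mult_cnj c_def)
qed

section \<open>The spectrum of the periodic fractional Laplacian on an interval\<close>

text \<open>
  As soon as a finite set \<open>K\<close> of wave vectors contains \<open>k\<close>, the \<open>k\<close>-th coefficient of the remainder
  \<open>r K\<close> of the series no longer depends on \<open>K\<close>: it is the difference of the two sides of the
  claim. It is also bounded by the mean-square norm of \<open>r K\<close>, which tends to zero.
\<close>

lemma fourier_coeff_frac_laplacian:
  fixes L :: real
  assumes "0 < L" and lap: "has_frac_laplacian \<alpha> L f g" and k: "k \<in> wave_vectors L"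
  shows "fourier_coeff L g k = of_real (norm k powr \<alpha>) * fourier_coeff L f k"
proof -
  define c where "c = (\<lambda>l. of_real (norm l powr \<alpha>) * fourier_coeff L f l)"
  define r where "r = (\<lambda>K x. g x - (\<Sum>l\<in>K. c l * plane_wave l x))"
  have g: "g \<in> L2_periodic L"
    and lim: "((\<lambda>K. LINT x|lebesgue_on (box 0 L). (cmod (r K x))\<^sup>2) \<longlongrightarrow> 0)
      (finite_subsets_at_top (wave_vectors L))"
    using lap by (auto simp: has_frac_laplacian_def r_def c_def)
  have "L * (cmod (fourier_coeff L g k - c k))\<^sup>2 \<le> (LINT x|lebesgue_on (box 0 L). (cmod (r K x))\<^sup>2)"
    if K: "finite K" "{k} \<subseteq> K" "K \<subseteq> wave_vectors L" for K
  proof -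
    have waves: "(\<lambda>x. c l * plane_wave l x) \<in> L2_periodic L" if "l \<in> K" for l
      using that K by (auto intro!: L2_periodic_cmult plane_wave_in_L2_periodic)
    then have s: "(\<lambda>x. \<Sum>l\<in>K. c l * plane_wave l x) \<in> L2_periodic L"
      by (rule L2_periodic_sum)
    have "fourier_coeff L (\<lambda>x. \<Sum>l\<in>K. c l * plane_wave l x) k
        = (\<Sum>l\<in>K. c l * fourier_coeff L (plane_wave l) k)"
      using fourier_coeff_sum[OF waves] by (simp add: fourier_coeff_cmult)
    also have "\<dots> = (\<Sum>l\<in>K. if l = k then c l else 0)"
      using K assms(1) k by (intro sum.cong) (auto simp: fourier_coeff_plane_wave)
    also have "\<dots> = c k"
      using K by simp
    finally have "fourier_coeff L (r K) k = fourier_coeff L g k - c k"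
      unfolding r_def using fourier_coeff_diff[OF g s] by simp
    moreover have "r K \<in> L2_periodic L"
      unfolding r_def using g s by (rule L2_periodic_diff)
    ultimately show ?thesis
      using fourier_coeff_bound[OF assms(1), of "r K" k] by simp
  qed
  then have "\<forall>\<^sub>F K in finite_subsets_at_top (wave_vectors L).
      L * (cmod (fourier_coeff L g k - c k))\<^sup>2 \<le> (LINT x|lebesgue_on (box 0 L). (cmod (r K x))\<^sup>2)"
    using k unfolding eventually_finite_subsets_at_top by (intro exI[of _ "{k}"]) auto
  then have "L * (cmod (fourier_coeff L g k - c k))\<^sup>2 \<le> 0"
    by (rule tendsto_lowerbound[OF lim]) simp
  then show ?thesis
    using assms(1) by (simp add: mult_le_0_iff c_def)
qed

lemma has_frac_laplacian_plane_wave: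
  fixes L :: real
  assumes "0 < L" and k: "k \<in> wave_vectors L"
  shows "has_frac_laplacian \<alpha> L (plane_wave k) (\<lambda>x. of_real (norm k powr \<alpha>) * plane_wave k x)"
proof -
  let ?c = "\<lambda>l. of_real (norm l powr \<alpha>) * fourier_coeff L (plane_wave k) l"
  have "(\<Sum>l\<in>K. ?c l * plane_wave l x) = of_real (norm k powr \<alpha>) * plane_wave k x"
    if K: "finite K" "{k} \<subseteq> K" "K \<subseteq> wave_vectors L" for K x
  proof -
    have "(\<Sum>l\<in>K. ?c l * plane_wave l x)
        = (\<Sum>l\<in>K. if l = k then of_real (norm k powr \<alpha>) * plane_wave k x else 0)"
      using K assms by (intro sum.cong) (auto simp: fourier_coeff_plane_wave)
    then show ?thesis
      using K by simp
  qed
  then have "\<forall>\<^sub>F K in finite_subsets_at_top (wave_vectors L).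
      (LINT x|lebesgue_on (box 0 L).
        (cmod (of_real (norm k powr \<alpha>) * plane_wave k x - (\<Sum>l\<in>K. ?c l * plane_wave l x)))\<^sup>2) = 0"
    using k unfolding eventually_finite_subsets_at_top by (intro exI[of _ "{k}"]) auto
  then show ?thesis
    unfolding has_frac_laplacian_def
    using k by (intro conjI tendsto_eventually) (auto intro: L2_periodic_cmult plane_wave_in_L2_periodic)
qed

text \<open>
  If \<open>\<mu>\<close> were none of the \<open>|k| powr \<alpha>\<close>, all coefficients of an eigenfunction \<open>f\<close> would vanish; then
  the series of its image \<open>\<mu> f\<close> is zero term by term, and \<open>\<mu> \<noteq> 0\<close> leaves only \<open>f = 0\<close>.
\<close>

lemma positive_eigenvalue_iff:
  fixes L \<mu> :: real
  assumes "0 < L" and "0 < \<mu>"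
  shows "periodic_eigenvalue \<alpha> L (\<lambda>x. 0) \<mu> \<longleftrightarrow> (\<exists>k\<in>wave_vectors L. \<mu> = norm k powr \<alpha>)"
proof
  assume "periodic_eigenvalue \<alpha> L (\<lambda>x. 0) \<mu>"
  then obtain f g where lap: "has_frac_laplacian \<alpha> L f g"
    and eq: "AE x in lebesgue_on (box 0 L). g x = of_real \<mu> * f x"
    and nz: "\<not> (AE x in lebesgue_on (box 0 L). f x = 0)"
    by (auto simp: periodic_eigenvalue_def)
  have f: "f \<in> L2_periodic L" and g: "g \<in> L2_periodic L"
    using lap by (auto simp: has_frac_laplacian_def)
  show "\<exists>k\<in>wave_vectors L. \<mu> = norm k powr \<alpha>"
  proof (rule ccontr)
    assume no: "\<not> (\<exists>k\<in>wave_vectors L. \<mu> = norm k powr \<alpha>)"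
    have zero: "fourier_coeff L f k = 0" if k: "k \<in> wave_vectors L" for k
    proof -
      have "of_real (norm k powr \<alpha>) * fourier_coeff L f k = fourier_coeff L g k"
        using fourier_coeff_frac_laplacian[OF assms(1) lap k] by simp
      also have "\<dots> = of_real \<mu> * fourier_coeff L f k"
        using fourier_coeff_cong_AE[OF g L2_periodic_cmult[OF f] eq] by (simp add: fourier_coeff_cmult)
      finally show ?thesis
        using no k by (auto simp del: real_norm_def)
    qed
    have "((\<lambda>K. LINT x|lebesgue_on (box 0 L). (cmod (g x))\<^sup>2) \<longlongrightarrow> 0)
        (finite_subsets_at_top (wave_vectors L))"
    proof (rule Lim_transform_eventually)
      show "((\<lambda>K. LINT x|lebesgue_on (box 0 L).
          (cmod (g x - (\<Sum>k\<in>K. of_real (norm k powr \<alpha>) * fourier_coeff L f k * plane_wave k x)))\<^sup>2)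
          \<longlongrightarrow> 0) (finite_subsets_at_top (wave_vectors L))"
        using lap by (simp add: has_frac_laplacian_def)
      show "\<forall>\<^sub>F K in finite_subsets_at_top (wave_vectors L). (LINT x|lebesgue_on (box 0 L).
          (cmod (g x - (\<Sum>k\<in>K. of_real (norm k powr \<alpha>) * fourier_coeff L f k * plane_wave k x)))\<^sup>2)
          = (LINT x|lebesgue_on (box 0 L). (cmod (g x))\<^sup>2)"
        by (rule eventually_finite_subsets_at_top_weakI) (auto simp: zero subset_iff)
    qed
    then have "(LINT x|lebesgue_on (box 0 L). (cmod (g x))\<^sup>2) = 0"
      by (simp add: tendsto_const_iff)
    then have "AE x in lebesgue_on (box 0 L). g x = 0"
      using integral_nonneg_eq_0_iff_AE[OF L2_periodic_square_integrable[OF g]] by simp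
    then have "AE x in lebesgue_on (box 0 L). f x = 0"
      using eq by eventually_elim (use assms(2) in simp)
    then show False
      using nz by simp
  qed
next
  assume "\<exists>k\<in>wave_vectors L. \<mu> = norm k powr \<alpha>"
  then obtain k where k: "k \<in> wave_vectors L" "\<mu> = norm k powr \<alpha>"
    by blast
  have "\<not> (AE x in lebesgue_on (box 0 L). plane_wave k x = 0)"
  proof
    assume ae: "AE x in lebesgue_on (box 0 L). plane_wave k x = 0"
    have "(\<lambda>x. 0) \<in> L2_periodic L"
      using L2_periodic_sum[of "{}"] by simp
    then have "fourier_coeff L (plane_wave k) k = fourier_coeff L (\<lambda>x. 0) k"
      using fourier_coeff_cong_AE[OF plane_wave_in_L2_periodic[OF k(1)] _ ae] by blast
    then show False
      using fourier_coeff_plane_wave[OF assms(1) k(1) k(1)] by (simp add: fourier_coeff_def)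
  qed
  then show "periodic_eigenvalue \<alpha> L (\<lambda>x. 0) \<mu>"
    unfolding periodic_eigenvalue_def
    using has_frac_laplacian_plane_wave[OF assms(1) k(1), of \<alpha>] k(2) by fastforce
qed

lemma positive_eigenvalue_interval:
  fixes L \<mu> :: real
  assumes "0 < L" and "0 < \<mu>"
  shows "periodic_eigenvalue \<alpha> L (\<lambda>x. 0) \<mu> \<longleftrightarrow>
    (\<exists>m::nat. 0 < m \<and> \<mu> = (2 * pi * real m / L) powr \<alpha>)"
proof -
  have waves: "k \<in> wave_vectors L \<longleftrightarrow> (\<exists>m::int. k = 2 * pi * of_int m / L)" for k
    by (simp add: wave_vectors_def)
  show ?thesis
    unfolding positive_eigenvalue_iff[OF assms]
  proof
    assume "\<exists>k\<in>wave_vectors L. \<mu> = norm k powr \<alpha>"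
    then obtain m :: int where m: "\<mu> = \<bar>2 * pi * of_int m / L\<bar> powr \<alpha>"
      by (auto simp: waves)
    \<comment> \<open>The constant mode is excluded, because \<open>0 powr \<alpha> = 0\<close> while \<open>\<mu>\<close> is positive.\<close>
    have "m \<noteq> 0"
      using m assms(2) by (intro notI) simp
    moreover have "\<bar>2 * pi * of_int m / L\<bar> = 2 * pi * real (nat \<bar>m\<bar>) / L"
      using assms(1) by (simp add: abs_mult)
    ultimately show "\<exists>m::nat. 0 < m \<and> \<mu> = (2 * pi * real m / L) powr \<alpha>"
      using m by (intro exI[of _ "nat \<bar>m\<bar>"]) simp
  next
    assume "\<exists>m::nat. 0 < m \<and> \<mu> = (2 * pi * real m / L) powr \<alpha>"
    then obtain m :: nat where m: "\<mu> = (2 * pi * real m / L) powr \<alpha>"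
      by blast
    show "\<exists>k\<in>wave_vectors L. \<mu> = norm k powr \<alpha>"
      using m assms(1)
      by (intro bexI[of _ "2 * pi * real m / L"]) (auto simp: waves intro: exI[of _ "int m"])
  qed
qed

theorem lemma5p2:
  fixes L\<^sub>1 \<alpha> :: real
  assumes "0 < L\<^sub>1" and "0 < \<alpha>" and "\<alpha> \<le> 2"
  shows "has_periodic_fundamental_gap \<alpha> L\<^sub>1 (\<lambda>x. 0)
    ((2 * pi) powr \<alpha> * (2 powr \<alpha> - 1) / L\<^sub>1 powr \<alpha>)"
proof -
  define ev where "ev = (\<lambda>m::nat. (2 * pi * real m / L\<^sub>1) powr \<alpha>)"
  have mono: "ev m < ev n" if "m < n" for m n
    unfolding ev_def using that assms by (intro powr_less_mono2 divide_strict_right_mono) auto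
  have pos: "0 < ev m" if "0 < m" for m
    using mono[OF that] by (simp add: ev_def)
  have ev_iff: "periodic_eigenvalue \<alpha> L\<^sub>1 (\<lambda>x. 0) \<mu> \<longleftrightarrow> (\<exists>m>0. \<mu> = ev m)" if "0 < \<mu>" for \<mu>
    using positive_eigenvalue_interval[OF assms(1) that] by (simp add: ev_def)
  have "\<mu> = ev 1 \<or> ev 2 \<le> \<mu>" if \<mu>: "0 < \<mu>" "periodic_eigenvalue \<alpha> L\<^sub>1 (\<lambda>x. 0) \<mu>" for \<mu>
  proof -
    obtain m where m: "0 < m" "\<mu> = ev m"
      using iffD1[OF ev_iff[OF \<mu>(1)] \<mu>(2)] by blast
    from m(1) consider "m = 1" | "m = 2" | "2 < m"
      by linarith
    then show ?thesis
      using m(2) mono[of 2 m] by cases (simp_all add: less_imp_le)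
  qed
  moreover have "(2 * pi) powr \<alpha> * (2 powr \<alpha> - 1) / L\<^sub>1 powr \<alpha> = ev 2 - ev 1"
    using assms by (simp add: ev_def powr_divide powr_mult field_simps)
  moreover have "periodic_eigenvalue \<alpha> L\<^sub>1 (\<lambda>x. 0) (ev m)" if "0 < m" for m
    by (rule iffD2[OF ev_iff[OF pos[OF that]]]) (use that in blast)
  ultimately show ?thesis
    unfolding has_periodic_fundamental_gap_def
    using pos[of 1] mono[of 1 2]
    by (intro exI[of _ "ev 1"] exI[of _ "ev 2"] conjI allI impI) simp_all
qed

end
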